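(* Let $n\ge1$ be an integer. (1) Let $a$ and $b$ be positive integers. Then $$[0;a,a+b,a+2b,\dots,a+(n-1)b]=\frac{\displaystyle\sum_{i=1}^{\lfloor(n+1)/2\rfloor}\binom{n-i}{i-1}\prod_{j=i}^{n-i}(a+jb)}{\displaystyle\sum_{i=0}^{\lfloor n/2\rfloor}\binom{n-i}{i}\prod_{j=i}^{n-1-i}(a+jb)}.$$ (2) Let $f,g,h,k$ be integers such that $2gh=k(2f+h)$. Then $$[0;f,g,f+h,g+k,\dots,f+(n-1)h,g+(n-1)k]=\frac{\displaystyle\sum_{i=1}^{n}\binom{2n-i}{i-1}\left(\frac{2g}{2f+h}\right)^{2n-i}\prod_{j=i}^{2n-i}\left(f+j\frac h2\right)}{\displaystyle\sum_{i=0}^{n}\binom{2n-i}{i}\left(\frac{2g}{2f+h}\right)^{2n-1-i}\prod_{j=i}^{2n-1-i}\left(f+j\frac h2\right)}.$$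
   Context: $[0;x_1,\dots,x_N]$ denotes the finite continued fraction $\cfrac{1}{x_1+\cfrac{1}{x_2+\cdots+\cfrac{1}{x_N}}}$. Empty products are equal to $1$. *)

theory Defs
  imports Complex_Main
begin

text \<open>The value of [0; x1, ..., xN], as the literal nested fraction 1/(x1 + 1/(x2 + ... + 1/xN)).
  It is only meaningful when no denominator vanishes (division by zero yields 0 in HOL); this is
  what \<open>cf0_defined\<close> expresses.\<close>

fun cf0 :: "real list \<Rightarrow> real" where
  "cf0 [] = 0"
| "cf0 (x # xs) = 1 / (x + cf0 xs)"

fun cf0_defined :: "real list \<Rightarrow> bool" where
  "cf0_defined [] \<longleftrightarrow> True"
| "cf0_defined (x # xs) \<longleftrightarrow> cf0_defined xs \<and> x + cf0 xs \<noteq> 0"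

definition arith_seq :: "int \<Rightarrow> int \<Rightarrow> nat \<Rightarrow> real list" where
  "arith_seq a b n = map (\<lambda>i. of_int (a + int i * b)) [0..<n]"

text \<open>The list f, g, f + h, g + k, ..., f + (n - 1) h, g + (n - 1) k, of length 2 n.\<close>

definition interleaved_seq :: "int \<Rightarrow> int \<Rightarrow> int \<Rightarrow> int \<Rightarrow> nat \<Rightarrow> real list" where
  "interleaved_seq f g h k n =
     concat (map (\<lambda>i. [of_int (f + int i * h), of_int (g + int i * k)]) [0..<n])"

end

theory Submission
  imports Defs
begin

text \<open>The convergents of a continued fraction are quotients of continuants. If \<open>2gh = k(2f + h)\<close>,
  then \<open>g + ik = r(f + (2i + 1)h/2)\<close> with \<open>r = 2g/(2f + h)\<close>, so both parts concern sequences
  \<open>s y\<^sub>0, t y\<^sub>1, s y\<^sub>2, t y\<^sub>3, ...\<close> with \<open>y\<close> arithmetic. Their continuants have an explicit binomial expansion,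
  because the continuant recurrence holds for it term by term. In the second part the powers of \<open>r\<close>
  in the stated numerator and denominator are those of the continuants times the common factor
  \<open>r ^ (n - 1)\<close>; this factor is nonzero, as \<open>g = 0\<close> would force \<open>k = 0\<close> and thus a vanishing last
  denominator.\<close>

section \<open>Continuants and definedness of continued fractions\<close>

fun continuant :: "'a::comm_semiring_1 list \<Rightarrow> 'a" where
  "continuant [] = 1"
| "continuant [x] = x"
| "continuant (x # y # zs) = x * continuant (y # zs) + continuant zs"

text \<open>Dividing the continuant recurrence by the continuant of the tail turns it into the
  recurrence for the nested fraction. Nonvanishing is carried through the induction because that
  division needs it.\<close>

lemma cf0_eq_continuant_quotient:
  assumes "cf0_defined (x # xs)"
  shows "continuant (x # xs) \<noteq> 0 \<and> cf0 (x # xs) = continuant xs / continuant (x # xs)"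
  using assms
proof (induction xs arbitrary: x)
  case Nil
  then show ?case by simp
next
  case (Cons y ys)
  have nz: "continuant (y # ys) \<noteq> 0"
    and q: "cf0 (y # ys) = continuant ys / continuant (y # ys)"
    using Cons by auto
  have "x + cf0 (y # ys) = continuant (x # y # ys) / continuant (y # ys)"
    using nz unfolding q by (simp add: field_simps)
  moreover have "x + cf0 (y # ys) \<noteq> 0"
    using Cons.prems by simp
  ultimately show ?case
    by (metis cf0.simps(2) divide_eq_0_iff divide_divide_eq_right mult_1)
qed

text \<open>Nonnegativity of the value strengthens the induction: it keeps the next denominator
  \<open>x + cf0 xs\<close> positive.\<close>

lemma cf0_defined_of_pos:
  assumes "\<And>x. x \<in> set xs \<Longrightarrow> x > 0"
  shows "cf0_defined xs \<and> cf0 xs \<ge> 0"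
  using assms
proof (induction xs)
  case Nil
  then show ?case by simp
next
  case (Cons x xs)
  then have "x > 0" "cf0 xs \<ge> 0" "cf0_defined xs" by auto
  then show ?case by simp
qed

text \<open>The innermost denominator is \<open>0 + cf0 [] = 0\<close>, and undefinedness of a tail
  passes to the whole list.\<close>

lemma not_cf0_defined_snoc_zero: "\<not> cf0_defined (xs @ [0])"
  by (induction xs) auto

section \<open>Binomial expansion of the continuants\<close>

text \<open>Exchanging \<open>s\<close> and \<open>t\<close> at each step makes the tail of such a
  list again a list of this kind, as the continuant recurrence requires.\<close>

fun alt_seq :: "'a::comm_ring_1 \<Rightarrow> 'a \<Rightarrow> 'a \<Rightarrow> 'a \<Rightarrow> nat \<Rightarrow> 'a list" where
  "alt_seq s t a b 0 = []"
| "alt_seq s t a b (Suc n) = s * a # alt_seq t s (a + b) b n"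

text \<open>By Euler's rule a continuant sums the products left after deleting disjoint adjacent
  pairs. This is the share of \<open>i\<close> deletions: each removes one \<open>s\<close> and one
  \<open>t\<close>, there are \<open>(n - i) choose i\<close> ways, and for arithmetic entries the
  sum collapses to that many copies of the middle product.\<close>

definition alt_term :: "'a::comm_ring_1 \<Rightarrow> 'a \<Rightarrow> 'a \<Rightarrow> 'a \<Rightarrow> nat \<Rightarrow> nat \<Rightarrow> 'a" where
  "alt_term s t a b n i = of_nat ((n - i) choose i) * s ^ ((n + 1) div 2 - i) *
     t ^ (n div 2 - i) * (\<Prod>j = i..<n - i. a + of_nat j * b)"

lemma prod_arith_shift:
  fixes a b :: "'a::comm_ring_1"
  shows "(\<Prod>j = m..<n. a + b + of_nat j * b) = (\<Prod>j = Suc m..<Suc n. a + of_nat j * b)"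
  by (simp only: prod.shift_bounds_Suc_ivl) (simp add: algebra_simps)

text \<open>Without deletions the term is the product of all entries, so the head simply splits
  off.\<close>

lemma alt_term_0:
  "alt_term s t a b (Suc (Suc n)) 0 = s * a * alt_term t s (a + b) b (Suc n) 0"
proof -
  have "(\<Prod>j = 0..<Suc (Suc n). a + of_nat j * b) =
      a * (\<Prod>j = Suc 0..<Suc (Suc n). a + of_nat j * b)"
    by (subst prod.atLeast_Suc_lessThan) auto
  then show ?thesis
    unfolding alt_term_def diff_zero prod_arith_shift
    by (simp add: mult_ac del: prod.op_ivl_Suc)
qed

text \<open>After cancelling the common factors, the coefficients of \<open>a\<close> and of \<open>b\<close> give Pascal's rule
  and the absorption identity.\<close>

lemma alt_term_Suc:
  assumes "2 * Suc i \<le> Suc (Suc n)"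
  shows "alt_term s t a b (Suc (Suc n)) (Suc i) =
    s * a * alt_term t s (a + b) b (Suc n) (Suc i) + alt_term s t (a + b + b) b n i"
proof (cases "n = 2 * i")
  \<comment> \<open>All entries are paired off: the outer terms are 1 and the middle binomial
    coefficient vanishes.\<close>
  case True
  then show ?thesis
    by (simp add: alt_term_def binomial_eq_0)
next
  case False
  with assms obtain d where n: "n = 2 * i + Suc d"
    by (metis Suc_le_mono add_Suc_right le_neq_implies_less less_imp_Suc_add mult_2 mult_Suc_right
        add_2_eq_Suc)
  define x where "x = (\<lambda>j. a + of_nat j * b)"
  \<comment> \<open>\<open>Q\<close> runs over the indices shared by all three products; the
    left-hand term has one more factor below this range, the last term one more above it.\<close>
  define Q where "Q = prod x {Suc (Suc i)..<Suc (Suc (i + d))}"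
  define p where "p = s ^ ((n + 1) div 2 - i) * t ^ (n div 2 - i)"
  have e: "s * (t ^ ((Suc n + 1) div 2 - Suc i) * s ^ (Suc n div 2 - Suc i)) = p"
  proof -
    \<comment> \<open>As \<open>n > 2 * i\<close>, the exponent of \<open>s\<close> is positive, so
      the factor \<open>s\<close> of the head entry can be absorbed.\<close>
    have "(n + 1) div 2 - i = Suc (Suc n div 2 - Suc i)" using n by simp
    then show ?thesis by (simp add: p_def algebra_simps)
  qed
  have P1: "prod x {Suc i..<Suc (Suc n) - Suc i} = x (Suc i) * Q"
    unfolding n Q_def by (subst prod.atLeast_Suc_lessThan) auto
  have P2: "(\<Prod>j = Suc i..<Suc n - Suc i. a + b + of_nat j * b) = Q"
    unfolding prod_arith_shift n Q_def x_def by simp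
  have P3: "(\<Prod>j = i..<n - i. a + b + b + of_nat j * b) = Q * x (Suc (Suc (i + d)))"
    unfolding prod_arith_shift n Q_def x_def by simp
  have pascal: "Suc (Suc (i + d)) choose Suc i = (Suc (i + d) choose i) + (Suc (i + d) choose Suc i)"
    by simp
  have absorb: "Suc i * (Suc (Suc (i + d)) choose Suc i) = Suc (Suc (i + d)) * (Suc (i + d) choose i)"
    using Suc_times_binomial_eq[of "Suc (i + d)" i] by (simp add: mult.commute)
  let ?A = "of_nat (Suc (Suc (i + d)) choose Suc i) :: 'a"
  let ?B = "of_nat (Suc (i + d) choose i) :: 'a"
  let ?C = "of_nat (Suc (i + d) choose Suc i) :: 'a"
  have A: "?A = ?B + ?C" using pascal by (metis of_nat_add)
  have B: "of_nat (Suc i) * ?A = of_nat (Suc (Suc (i + d))) * ?B" using absorb by (metis of_nat_mult)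
  have key: "?A * x (Suc i) = a * ?C + ?B * x (Suc (Suc (i + d)))"
  proof -
    have "?A * x (Suc i) = a * ?A + b * (of_nat (Suc i) * ?A)"
      unfolding x_def by (simp only: algebra_simps)
    also have "\<dots> = a * (?B + ?C) + b * (of_nat (Suc (Suc (i + d))) * ?B)"
      by (simp only: A[symmetric] B)
    finally show ?thesis unfolding x_def by (simp only: algebra_simps)
  qed
  have "alt_term s t a b (Suc (Suc n)) (Suc i) = ?A * p * (x (Suc i) * Q)"
    unfolding alt_term_def P1[unfolded x_def] by (simp add: n p_def x_def del: binomial_Suc_Suc of_nat_Suc)
  also have "\<dots> = (?A * x (Suc i)) * p * Q" by (simp only: mult_ac)
  also have "\<dots> = (a * ?C + ?B * x (Suc (Suc (i + d)))) * p * Q" by (simp only: key)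
  also have "\<dots> = a * ?C * p * Q + ?B * p * (Q * x (Suc (Suc (i + d))))"
    by (simp only: algebra_simps)
  also have "a * ?C * p * Q = s * a * alt_term t s (a + b) b (Suc n) (Suc i)"
  proof -
    have "Suc n - Suc i = Suc (i + d)" using n by simp
    then show ?thesis
      unfolding alt_term_def P2 e[symmetric] by (simp only: mult_ac)
  qed
  also have "?B * p * (Q * x (Suc (Suc (i + d)))) = alt_term s t (a + b + b) b n i"
  proof -
    have "n - i = Suc (i + d)" using n by simp
    then show ?thesis
      unfolding alt_term_def P3 p_def by (simp only: mult_ac)
  qed
  finally show ?thesis .
qed

text \<open>The recurrence reaches back two lengths, hence the two-step induction; the parameters
  are generalised because the tail exchanges \<open>s\<close> and \<open>t\<close> and moves
  \<open>a\<close>.\<close>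

theorem continuant_alt_seq:
  "continuant (alt_seq s t a b n) = (\<Sum>i\<le>n div 2. alt_term s t a b n i)"
proof (induction n arbitrary: s t a b rule: induct_nat_012)
  case 0
  then show ?case by (simp add: alt_term_def)
next
  case 1
  then show ?case by (simp add: alt_term_def)
next
  case (ge2 n)
  \<comment> \<open>For even \<open>n\<close> the sum for the tail is one term shorter than needed;
    the term added has a zero binomial coefficient.\<close>
  have ext: "(\<Sum>i\<le>Suc n div 2. alt_term t s (a + b) b (Suc n) i) =
      (\<Sum>i\<le>Suc (n div 2). alt_term t s (a + b) b (Suc n) i)"
  proof (rule sum.mono_neutral_left)
    show "\<forall>i\<in>{..Suc (n div 2)} - {..Suc n div 2}. alt_term t s (a + b) b (Suc n) i = 0"
    proof
      fix i assume "i \<in> {..Suc (n div 2)} - {..Suc n div 2}"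
      then have "Suc n - i < i" by auto
      then show "alt_term t s (a + b) b (Suc n) i = 0"
        by (simp add: alt_term_def binomial_eq_0)
    qed
  qed auto
  have "continuant (alt_seq s t a b (Suc (Suc n))) =
      s * a * (\<Sum>i\<le>Suc n div 2. alt_term t s (a + b) b (Suc n) i) +
      (\<Sum>i\<le>n div 2. alt_term s t (a + b + b) b n i)"
    using ge2[symmetric] by simp
  also have "\<dots> = s * a * alt_term t s (a + b) b (Suc n) 0 + (\<Sum>i\<le>n div 2.
      s * a * alt_term t s (a + b) b (Suc n) (Suc i) + alt_term s t (a + b + b) b n i)"
    unfolding ext sum.atMost_Suc_shift
    by (simp add: sum.distrib sum_distrib_left algebra_simps)
  also have "\<dots> = alt_term s t a b (Suc (Suc n)) 0 +
      (\<Sum>i\<le>n div 2. alt_term s t a b (Suc (Suc n)) (Suc i))"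
    by (intro arg_cong2[of _ _ _ _ "(+)"] sum.cong alt_term_0[symmetric] alt_term_Suc[symmetric])
      auto
  also have "\<dots> = (\<Sum>i\<le>Suc (Suc n) div 2. alt_term s t a b (Suc (Suc n)) i)"
    by (simp add: sum.atMost_Suc_shift del: sum.atMost_Suc)
  finally show ?case .
qed

text \<open>This is the numerator, the continuant of the tail. Writing its terms with
  \<open>a\<close> instead of \<open>a + b\<close> shifts the products by one; the summation index
  is shifted along with them.\<close>

corollary continuant_alt_seq_shifted:
  assumes "n \<ge> 1"
  shows "continuant (alt_seq t s (a + b) b (n - 1)) =
    (\<Sum>i = 1..(n + 1) div 2. of_nat ((n - i) choose (i - 1)) * t ^ (n div 2 - (i - 1)) *
       s ^ ((n + 1) div 2 - i) * (\<Prod>j = i..n - i. a + of_nat j * b))"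
proof -
  have "continuant (alt_seq t s (a + b) b (n - 1)) =
      (\<Sum>i\<in>{0..<(n + 1) div 2}. alt_term t s (a + b) b (n - 1) i)"
    \<comment> \<open>The bounds agree since \<open>(n - 1) div 2 + 1 = (n + 1) div 2\<close> for
      \<open>n \<ge> 1\<close>.\<close>
    unfolding continuant_alt_seq using assms by (intro sum.cong) auto
  also have "\<dots> = (\<Sum>i\<in>{Suc 0..<Suc ((n + 1) div 2)}. alt_term t s (a + b) b (n - 1) (i - 1))"
    by (simp only: sum.shift_bounds_Suc_ivl) simp
  also have "\<dots> = (\<Sum>i = 1..(n + 1) div 2.
      of_nat ((n - i) choose (i - 1)) * t ^ (n div 2 - (i - 1)) *
      s ^ ((n + 1) div 2 - i) * (\<Prod>j = i..n - i. a + of_nat j * b))"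
  proof (rule sum.cong)
    fix i assume "i \<in> {1..(n + 1) div 2}"
    then have i: "1 \<le> i" "i \<le> (n + 1) div 2" by auto
    then have "n - 1 - (i - 1) = n - i" "(n - 1 + 1) div 2 = n div 2"
      "(n - 1) div 2 - (i - 1) = (n + 1) div 2 - i" "{Suc (i - 1)..<Suc (n - i)} = {i..n - i}"
      using assms by auto
    then show "alt_term t s (a + b) b (n - 1) (i - 1) =
      of_nat ((n - i) choose (i - 1)) * t ^ (n div 2 - (i - 1)) *
      s ^ ((n + 1) div 2 - i) * (\<Prod>j = i..n - i. a + of_nat j * b)"
      unfolding alt_term_def prod_arith_shift by simp
  qed auto
  finally show ?thesis .
qed

lemma cf0_alt_seq:
  assumes "n \<ge> 1" and "cf0_defined (alt_seq s t a b n)"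
  shows "cf0 (alt_seq s t a b n) =
    (\<Sum>i = 1..(n + 1) div 2. real ((n - i) choose (i - 1)) * t ^ (n div 2 - (i - 1)) *
       s ^ ((n + 1) div 2 - i) * (\<Prod>j = i..n - i. a + real j * b)) /
    (\<Sum>i = 0..n div 2. real ((n - i) choose i) * s ^ ((n + 1) div 2 - i) *
       t ^ (n div 2 - i) * (\<Prod>j = i..n - 1 - i. a + real j * b))"
proof -
  have seq: "alt_seq s t a b n = s * a # alt_seq t s (a + b) b (n - 1)"
    using assms(1) by (cases n) auto
  have "cf0 (alt_seq s t a b n) =
      continuant (alt_seq t s (a + b) b (n - 1)) / continuant (alt_seq s t a b n)"
    using cf0_eq_continuant_quotient assms(2) unfolding seq by blast
  also have "continuant (alt_seq s t a b n) =
      (\<Sum>i = 0..n div 2. real ((n - i) choose i) * s ^ ((n + 1) div 2 - i) *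
        t ^ (n div 2 - i) * (\<Prod>j = i..n - 1 - i. a + real j * b))"
    unfolding continuant_alt_seq atLeast0AtMost
  proof (rule sum.cong)
    fix i assume "i \<in> {..n div 2}"
    \<comment> \<open>For \<open>n = 0\<close> truncated subtraction would turn the empty range into
      \<open>{0..0}\<close>; \<open>n \<ge> 1\<close> excludes this.\<close>
    then have "{i..<n - i} = {i..n - 1 - i}"
      using assms(1) by auto
    then show "alt_term s t a b n i = real ((n - i) choose i) * s ^ ((n + 1) div 2 - i) *
        t ^ (n div 2 - i) * (\<Prod>j = i..n - 1 - i. a + real j * b)"
      by (simp add: alt_term_def)
  qed simp
  finally show ?thesis
    unfolding continuant_alt_seq_shifted[OF assms(1)] .
qed

section \<open>The two given sequences as alternating lists\<close>

lemma arith_seq_eq_alt_seq: "arith_seq a b n = alt_seq 1 1 (of_int a) (of_int b) n"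
proof (induction n arbitrary: a)
  case 0
  then show ?case by (simp add: arith_seq_def)
next
  case (Suc n)
  have "arith_seq a b (Suc n) = of_int a # arith_seq (a + b) b n"
    unfolding arith_seq_def
    by (subst upt_conv_Cons, simp, simp add: map_Suc_upt[symmetric] algebra_simps del: upt_Suc)
  then show ?case using Suc by simp
qed

lemma interleaved_seq_Suc:
  "interleaved_seq f g h k (Suc n) = of_int f # of_int g # interleaved_seq (f + h) (g + k) h k n"
  unfolding interleaved_seq_def
  by (subst upt_conv_Cons, simp, simp add: map_Suc_upt[symmetric] algebra_simps comp_def del: upt_Suc)

text \<open>Each pair of entries advances the progression by two half-steps \<open>h / 2\<close>.
  The condition on \<open>k\<close> carries the condition on \<open>g\<close> over to
  \<open>f + h\<close> and \<open>g + k\<close>.\<close>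

lemma interleaved_seq_eq_alt_seq:
  assumes "of_int g = r * (of_int f + of_int h / 2)" and "of_int k = r * of_int h"
  shows "interleaved_seq f g h k n = alt_seq 1 r (of_int f) (of_int h / 2) (2 * n)"
  using assms(1)
proof (induction n arbitrary: f g)
  case 0
  then show ?case by (simp add: interleaved_seq_def)
next
  case (Suc n)
  have "of_int (g + k) = r * (of_int (f + h) + of_int h / 2)"
    using Suc.prems assms(2) by (simp add: algebra_simps)
  from Suc.IH[OF this] show ?case
    using Suc.prems by (simp add: interleaved_seq_Suc add.assoc)
qed

theorem corollary7:
  fixes n :: nat
  assumes "n \<ge> 1"
  shows "(\<forall>a b :: int. a > 0 \<longrightarrow> b > 0 \<longrightarrow>
      cf0 (arith_seq a b n) =
        (\<Sum>i = 1..(n + 1) div 2. real ((n - i) choose (i - 1)) *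
           (\<Prod>j = i..n - i. real_of_int a + real j * real_of_int b)) /
        (\<Sum>i = 0..n div 2. real ((n - i) choose i) *
           (\<Prod>j = i..n - 1 - i. real_of_int a + real j * real_of_int b)))
    \<and> (\<forall>f g h k :: int. 2 * g * h = k * (2 * f + h) \<longrightarrow> 2 * f + h \<noteq> 0 \<longrightarrow>
      cf0_defined (interleaved_seq f g h k n) \<longrightarrow>
      cf0 (interleaved_seq f g h k n) =
        (\<Sum>i = 1..n. real ((2 * n - i) choose (i - 1)) *
           (2 * real_of_int g / (2 * real_of_int f + real_of_int h)) ^ (2 * n - i) *
           (\<Prod>j = i..2 * n - i. real_of_int f + real j * (real_of_int h / 2))) /
        (\<Sum>i = 0..n. real ((2 * n - i) choose i) *
           (2 * real_of_int g / (2 * real_of_int f + real_of_int h)) ^ (2 * n - 1 - i) *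
           (\<Prod>j = i..2 * n - 1 - i. real_of_int f + real j * (real_of_int h / 2))))"
proof (intro conjI allI impI)
  fix a b :: int
  assume "a > 0" "b > 0"
  then have "cf0_defined (arith_seq a b n)"
    by (intro conjunct1[OF cf0_defined_of_pos]) (auto simp: arith_seq_def add_pos_nonneg)
  then show "cf0 (arith_seq a b n) =
        (\<Sum>i = 1..(n + 1) div 2. real ((n - i) choose (i - 1)) *
           (\<Prod>j = i..n - i. real_of_int a + real j * real_of_int b)) /
        (\<Sum>i = 0..n div 2. real ((n - i) choose i) *
           (\<Prod>j = i..n - 1 - i. real_of_int a + real j * real_of_int b))"
    using cf0_alt_seq[OF assms, of 1 1] unfolding arith_seq_eq_alt_seq by simp
next
  fix f g h k :: int
  assume eq: "2 * g * h = k * (2 * f + h)" and nz: "2 * f + h \<noteq> 0"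
    and d: "cf0_defined (interleaved_seq f g h k n)"
  define r where "r = 2 * real_of_int g / (2 * real_of_int f + real_of_int h)"
  have nz': "2 * real_of_int f + real_of_int h \<noteq> 0"
    using nz by (metis of_int_add of_int_eq_0_iff of_int_mult of_int_numeral)
  have g: "of_int g = r * (of_int f + of_int h / 2)"
    using nz' by (simp add: r_def field_simps)
  \<comment> \<open>This is the hypothesis \<open>eq\<close> divided by
    \<open>2 * f + h\<close>.\<close>
  have k: "of_int k = r * of_int h"
  proof -
    have "2 * real_of_int g * of_int h = of_int k * (2 * of_int f + of_int h)"
      using eq by (metis of_int_add of_int_mult of_int_numeral)
    then show ?thesis using nz' by (simp add: r_def field_simps)
  qed
  have seq: "interleaved_seq f g h k n = alt_seq 1 r (of_int f) (of_int h / 2) (2 * n)"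
    by (rule interleaved_seq_eq_alt_seq[OF g k])
  have "r \<noteq> 0"
  proof
    assume "r = 0"
    then have "g = 0" "k = 0" using g k by simp_all
    moreover obtain m where "n = Suc m" using assms by (cases n) auto
    ultimately have "interleaved_seq f g h k n =
        (interleaved_seq f g h k m @ [of_int (f + int m * h)]) @ [0]"
      by (simp add: interleaved_seq_def)
    then show False using d not_cf0_defined_snoc_zero by metis
  qed
  let ?P = "\<lambda>i m. \<Prod>j = i..m. real_of_int f + real j * (real_of_int h / 2)"
  \<comment> \<open>At length \<open>2 * n\<close> with \<open>s = 1\<close> and
    \<open>t = r\<close>, the powers of \<open>r\<close> are \<open>n - (i - 1)\<close> above and
    \<open>n - i\<close> below; \<open>r ^ (n - 1)\<close> raises them to \<open>2 * n - i\<close>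
    and \<open>2 * n - 1 - i\<close>.\<close>
  let ?N = "\<Sum>i = 1..n. real ((2 * n - i) choose (i - 1)) * r ^ (n - (i - 1)) * ?P i (2 * n - i)"
  let ?D = "\<Sum>i = 0..n. real ((2 * n - i) choose i) * r ^ (n - i) * ?P i (2 * n - 1 - i)"
  have "cf0 (interleaved_seq f g h k n) = ?N / ?D"
    using cf0_alt_seq[of "2 * n" 1 r] assms d unfolding seq by simp
  also have "\<dots> = (r ^ (n - 1) * ?N) / (r ^ (n - 1) * ?D)"
    using \<open>r \<noteq> 0\<close> by simp
  also have "r ^ (n - 1) * ?N =
      (\<Sum>i = 1..n. real ((2 * n - i) choose (i - 1)) * r ^ (2 * n - i) * ?P i (2 * n - i))"
    unfolding sum_distrib_left
  proof (rule sum.cong)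
    fix i assume "i \<in> {1..n}"
    then have "2 * n - i = (n - 1) + (n - (i - 1))" by auto
    then have "r ^ (2 * n - i) = r ^ (n - 1) * r ^ (n - (i - 1))" by (metis power_add)
    then show "r ^ (n - 1) * (real ((2 * n - i) choose (i - 1)) * r ^ (n - (i - 1)) *
        ?P i (2 * n - i)) = real ((2 * n - i) choose (i - 1)) * r ^ (2 * n - i) * ?P i (2 * n - i)"
      by simp
  qed simp
  also have "r ^ (n - 1) * ?D =
      (\<Sum>i = 0..n. real ((2 * n - i) choose i) * r ^ (2 * n - 1 - i) * ?P i (2 * n - 1 - i))"
    unfolding sum_distrib_left
  proof (rule sum.cong)
    fix i assume "i \<in> {0..n}"
    then have "2 * n - 1 - i = (n - 1) + (n - i)" using assms by auto
    then have "r ^ (2 * n - 1 - i) = r ^ (n - 1) * r ^ (n - i)" by (metis power_add)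
    then show "r ^ (n - 1) * (real ((2 * n - i) choose i) * r ^ (n - i) * ?P i (2 * n - 1 - i)) =
        real ((2 * n - i) choose i) * r ^ (2 * n - 1 - i) * ?P i (2 * n - 1 - i)"
      by simp
  qed simp
  finally show "cf0 (interleaved_seq f g h k n) =
        (\<Sum>i = 1..n. real ((2 * n - i) choose (i - 1)) *
           (2 * real_of_int g / (2 * real_of_int f + real_of_int h)) ^ (2 * n - i) *
           (\<Prod>j = i..2 * n - i. real_of_int f + real j * (real_of_int h / 2))) /
        (\<Sum>i = 0..n. real ((2 * n - i) choose i) *
           (2 * real_of_int g / (2 * real_of_int f + real_of_int h)) ^ (2 * n - 1 - i) *
           (\<Prod>j = i..2 * n - 1 - i. real_of_int f + real j * (real_of_int h / 2)))"
    unfolding r_def .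
qed

end
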